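(* Let $G=(V,E)$ be an infinite, locally finite, connected graph without loops or multiple edges, and fix a vertex $x_0\in V$. Suppose there is a constant $c$ such that for all vertices $x$ of $G$ $$\frac{m_{+1}(x)-m_{-1}(x)}{m(x)}\ge c>0 ,$$ and that $\underline{m}_c(r)=\inf_{x\in G\setminus B_r}m(x)$ satisfies $\underline{m}_c(r)\to\infty$ as $r\to\infty$. Then $\sigma_{ess}(\Delta)=\emptyset$.
   Context: $m(x)$ is the valence of $x$; $r(x)=d(x,x_0)$ is the graph distance to $x_0$; $m_{+1}(x)=|\{y\sim x: r(y)=r(x)+1\}|$ and $m_{-1}(x)=|\{y\sim x: r(y)=r(x)-1\}|$. $B_r$ is the ball of radius $r$ about $x_0$, i.e. the vertices with $r(x)\le r$; $x\in G\setminus B_r$ means that $x$ is a vertex with $r(x)>r$. $\Delta f(x)=\sum_{y\sim x}(f(x)-f(y))$ is regarded as an operator on $\ell^2(V)$ (counting measure) with domain $\{f\in\ell^2(V):\Delta f\in\ell^2(V)\}$; it is self-adjoint on this domain. $\sigma_{ess}(\Delta)$ is its essential spectrum: $\lambda\in\sigma_{ess}(\Delta)$ if and only if there is an orthonormal sequence $f_i$ in the domain of $\Delta$ with $\Delta f_i-\lambda f_i\to0$ in $\ell^2(V)$. *)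

theory Defs
  imports "HOL-Analysis.Analysis"
begin

section \<open>Graphs\<close>

text \<open>A graph is given by a vertex set \<open>V\<close> and a set \<open>E\<close> of edges, each a two-element set of
  vertices; so there are no loops and no multiple edges.\<close>

definition simple_graph :: "'a set \<Rightarrow> 'a set set \<Rightarrow> bool" where
  "simple_graph V E \<longleftrightarrow> (\<forall>e\<in>E. e \<subseteq> V \<and> card e = 2)"

definition neighbours :: "'a set set \<Rightarrow> 'a \<Rightarrow> 'a set" where
  "neighbours E x = {y. {x, y} \<in> E}"

definition valence :: "'a set set \<Rightarrow> 'a \<Rightarrow> nat" where
  "valence E x = card (neighbours E x)"

definition locally_finite :: "'a set \<Rightarrow> 'a set set \<Rightarrow> bool" where
  "locally_finite V E \<longleftrightarrow> (\<forall>x\<in>V. finite (neighbours E x))"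

definition adj_rel :: "'a set set \<Rightarrow> ('a \<times> 'a) set" where
  "adj_rel E = {(x, y). {x, y} \<in> E}"

definition graph_connected :: "'a set \<Rightarrow> 'a set set \<Rightarrow> bool" where
  "graph_connected V E \<longleftrightarrow> (\<forall>x\<in>V. \<forall>y\<in>V. (x, y) \<in> (adj_rel E)\<^sup>*)"

text \<open>\<open>(x, y) \<in> adj_rel E ^^ n\<close> says that there is a walk with \<open>n\<close> edges from \<open>x\<close> to \<open>y\<close>. The value
  is meaningful only for vertices joined by a walk.\<close>

definition graph_dist :: "'a set set \<Rightarrow> 'a \<Rightarrow> 'a \<Rightarrow> nat" where
  "graph_dist E x y = (LEAST n. (x, y) \<in> adj_rel E ^^ n)"

definition m_plus :: "'a set set \<Rightarrow> 'a \<Rightarrow> 'a \<Rightarrow> nat" where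
  "m_plus E x0 x = card {y \<in> neighbours E x. graph_dist E y x0 = graph_dist E x x0 + 1}"

text \<open>The equation \<open>r(y) = r(x) - 1\<close> is written additively because subtraction on \<^typ>\<open>nat\<close>
  truncates.\<close>

definition m_minus :: "'a set set \<Rightarrow> 'a \<Rightarrow> 'a \<Rightarrow> nat" where
  "m_minus E x0 x = card {y \<in> neighbours E x. graph_dist E y x0 + 1 = graph_dist E x x0}"

definition graph_ball :: "'a set \<Rightarrow> 'a set set \<Rightarrow> 'a \<Rightarrow> nat \<Rightarrow> 'a set" where
  "graph_ball V E x0 r = {x \<in> V. graph_dist E x x0 \<le> r}"

text \<open>The infimum is taken in \<^typ>\<open>nat\<close>. In an infinite, connected, locally finite graph the index
  set is never empty, so the value of an infimum over the empty set plays no role.\<close>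

definition min_valence_outside :: "'a set \<Rightarrow> 'a set set \<Rightarrow> 'a \<Rightarrow> nat \<Rightarrow> nat" where
  "min_valence_outside V E x0 r = (INF x \<in> V - graph_ball V E x0 r. valence E x)"


section \<open>The Laplacian on square-summable functions\<close>

text \<open>Elements of the complex Hilbert space \<open>\<ell>\<^sup>2(V)\<close> are represented by functions on the whole type.
  Everything below depends only on their values on \<open>V\<close>.\<close>

definition l2 :: "'a set \<Rightarrow> ('a \<Rightarrow> complex) set" where
  "l2 V = {f. (\<lambda>x. (cmod (f x))\<^sup>2) summable_on V}"

definition l2_inner :: "'a set \<Rightarrow> ('a \<Rightarrow> complex) \<Rightarrow> ('a \<Rightarrow> complex) \<Rightarrow> complex" where
  "l2_inner V f g = (\<Sum>\<^sub>\<infinity>x\<in>V. f x * cnj (g x))"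

definition l2_norm :: "'a set \<Rightarrow> ('a \<Rightarrow> complex) \<Rightarrow> real" where
  "l2_norm V f = sqrt (\<Sum>\<^sub>\<infinity>x\<in>V. (cmod (f x))\<^sup>2)"

definition laplacian :: "'a set set \<Rightarrow> ('a \<Rightarrow> complex) \<Rightarrow> 'a \<Rightarrow> complex" where
  "laplacian E f x = (\<Sum>y\<in>neighbours E x. f x - f y)"

definition laplacian_domain :: "'a set \<Rightarrow> 'a set set \<Rightarrow> ('a \<Rightarrow> complex) set" where
  "laplacian_domain V E = {f \<in> l2 V. laplacian E f \<in> l2 V}"

definition orthonormal_seq :: "'a set \<Rightarrow> (nat \<Rightarrow> 'a \<Rightarrow> complex) \<Rightarrow> bool" where
  "orthonormal_seq V f \<longleftrightarrow> (\<forall>i j. l2_inner V (f i) (f j) = (if i = j then 1 else 0))"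

definition essential_spectrum :: "'a set \<Rightarrow> 'a set set \<Rightarrow> complex set" where
  "essential_spectrum V E =
    {z. \<exists>f :: nat \<Rightarrow> 'a \<Rightarrow> complex.
          (\<forall>i. f i \<in> laplacian_domain V E) \<and> orthonormal_seq V f \<and>
          (\<lambda>i. l2_norm V (\<lambda>x. laplacian E (f i) x - z * f i x)) \<longlonglongrightarrow> 0}"

end

theory Submission
  imports Defs
begin

text \<open>
  The reason is an energy estimate on the maximal domain: there is \<open>k > 0\<close> such that every \<open>f\<close> in
  the domain of the Laplacian satisfies
  \<open>k * (\<Sum>x. m(x) * |f(x)|\<^sup>2) \<le> (\<parallel>f\<parallel>\<^sup>2 + \<parallel>\<Delta> f\<parallel>\<^sup>2) / 2\<close>.
  Along an orthonormal sequence with \<open>\<Delta> f\<^sub>i - z f\<^sub>i \<longlonglongrightarrow> 0\<close> the right-hand side stays bounded. Since the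
  valence \<open>m\<close> tends to infinity, at most half of the mass of \<open>f\<^sub>i\<close> lies outside some ball, uniformly
  in large \<open>i\<close>. That ball is finite, and by Bessel's inequality \<open>f\<^sub>i\<close> tends to \<open>0\<close> at each of its
  vertices, so the mass inside tends to \<open>0\<close>. This contradicts \<open>\<parallel>f\<^sub>i\<parallel> = 1\<close>.

  The constant \<open>k\<close> comes from a positive function \<open>u\<close> with \<open>\<Delta> u \<ge> k m u\<close>. The hypothesis on
  \<open>m\<^sub>+\<^sub>1 - m\<^sub>-\<^sub>1\<close> makes \<open>u(x) = s ^ r(x)\<close> such a function once \<open>s < 1\<close> is close enough to \<open>1\<close>
  (\<open>radial_power_supersolution\<close>). Comparing a finitely supported \<open>\<psi>\<close> with \<open>u\<close> edge by edge
  then gives \<open>k * (\<Sum>x. m(x) * \<psi>(x)\<^sup>2) \<le> \<langle>\<Delta> \<psi>, \<psi>\<rangle>\<close> (\<open>ground_state_inequality\<close>).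

  The step from finitely supported functions to the maximal domain is made by truncation rather
  than by approximating \<open>f\<close> in the graph norm: \<open>\<psi> = max 0 (|f| - \<epsilon>)\<close> has finite support because
  \<open>f\<close> is square-summable, and a discrete Kato inequality gives \<open>\<Delta> \<psi> \<le> |\<Delta> f|\<close> on that support
  (\<open>truncation_kato_inequality\<close>). So \<open>\<langle>\<Delta> \<psi>, \<psi>\<rangle>\<close> is at most the sum of \<open>|\<Delta> f| * |f|\<close>, and letting
  \<open>\<epsilon>\<close> tend to \<open>0\<close> yields the estimate (\<open>laplacian_domain_weighted_bound\<close>).
\<close>

section \<open>Square-summable functions\<close>

lemma has_sum_finite_sum:
  fixes f :: "'i \<Rightarrow> 'b \<Rightarrow> 'c::topological_comm_monoid_add"
  assumes "finite I" "\<And>i. i \<in> I \<Longrightarrow> (f i has_sum s i) A"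
  shows "((\<lambda>x. \<Sum>i\<in>I. f i x) has_sum (\<Sum>i\<in>I. s i)) A"
  using assms by (induction I rule: finite_induct) (auto intro: has_sum_add)

lemma l2_add_bound:
  assumes "f \<in> l2 V" "g \<in> l2 V"
  shows "(\<lambda>x. f x + a * g x) \<in> l2 V"
    and "(\<Sum>\<^sub>\<infinity>x\<in>V. (cmod (f x + a * g x))\<^sup>2)
       \<le> 2 * (\<Sum>\<^sub>\<infinity>x\<in>V. (cmod (f x))\<^sup>2) + 2 * (cmod a)\<^sup>2 * (\<Sum>\<^sub>\<infinity>x\<in>V. (cmod (g x))\<^sup>2)"
proof -
  let ?h = "\<lambda>x. 2 * (cmod (f x))\<^sup>2 + 2 * (cmod a)\<^sup>2 * (cmod (g x))\<^sup>2"
  have f: "(\<lambda>x. (cmod (f x))\<^sup>2) summable_on V" and g: "(\<lambda>x. (cmod (g x))\<^sup>2) summable_on V"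
    using assms by (auto simp: l2_def)
  have le: "(cmod (f x + a * g x))\<^sup>2 \<le> ?h x" for x
  proof -
    have "(cmod (f x + a * g x))\<^sup>2 \<le> (cmod (f x) + cmod a * cmod (g x))\<^sup>2"
      by (intro power_mono) (auto intro: order_trans[OF norm_triangle_ineq] simp: norm_mult)
    also have "\<dots> \<le> ?h x"
      using zero_le_power2[of "cmod (f x) - cmod a * cmod (g x)"]
      by (simp add: power2_eq_square algebra_simps)
    finally show ?thesis .
  qed
  have h: "?h summable_on V"
    by (intro summable_on_add summable_on_cmult_right f g)
  then have s: "(\<lambda>x. (cmod (f x + a * g x))\<^sup>2) summable_on V"
    by (rule summable_on_comparison_test) (use le in auto)
  then show "(\<lambda>x. f x + a * g x) \<in> l2 V"
    by (simp add: l2_def)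
  have "(\<Sum>\<^sub>\<infinity>x\<in>V. (cmod (f x + a * g x))\<^sup>2) \<le> infsum ?h V"
    by (rule infsum_mono[OF s h le])
  also have "\<dots> = 2 * (\<Sum>\<^sub>\<infinity>x\<in>V. (cmod (f x))\<^sup>2) + 2 * (cmod a)\<^sup>2 * (\<Sum>\<^sub>\<infinity>x\<in>V. (cmod (g x))\<^sup>2)"
    by (subst infsum_add) (auto intro!: summable_on_cmult_right f g simp: infsum_cmult_right')
  finally show "(\<Sum>\<^sub>\<infinity>x\<in>V. (cmod (f x + a * g x))\<^sup>2)
       \<le> 2 * (\<Sum>\<^sub>\<infinity>x\<in>V. (cmod (f x))\<^sup>2) + 2 * (cmod a)\<^sup>2 * (\<Sum>\<^sub>\<infinity>x\<in>V. (cmod (g x))\<^sup>2)" .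
qed

lemma l2_finite_superlevel:
  assumes "f \<in> l2 V" "\<epsilon> > 0"
  shows "finite {x \<in> V. \<epsilon> < cmod (f x)}"
proof (rule ccontr)
  let ?N = "\<Sum>\<^sub>\<infinity>x\<in>V. (cmod (f x))\<^sup>2"
  assume inf: "infinite {x \<in> V. \<epsilon> < cmod (f x)}"
  obtain n :: nat where n: "?N / \<epsilon>\<^sup>2 < n"
    using reals_Archimedean2 by blast
  obtain T where T: "finite T" "card T = n" "T \<subseteq> {x \<in> V. \<epsilon> < cmod (f x)}"
    using infinite_arbitrarily_large[OF inf] by blast
  have "n * \<epsilon>\<^sup>2 = (\<Sum>x\<in>T. \<epsilon>\<^sup>2)"
    using T by simp
  also have "\<dots> \<le> (\<Sum>x\<in>T. (cmod (f x))\<^sup>2)"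
    using T assms by (intro sum_mono power_mono) auto
  also have "\<dots> \<le> ?N"
    using T assms by (intro finite_sum_le_infsum) (auto simp: l2_def)
  finally show False
    using n assms by (simp add: field_simps)
qed

lemma l2_inner_summable:
  assumes "f \<in> l2 V" "g \<in> l2 V"
  shows "(\<lambda>x. f x * cnj (g x)) summable_on V"
proof -
  have "(\<lambda>x. (cmod (f x))\<^sup>2 + (cmod (g x))\<^sup>2) summable_on V"
    using assms by (intro summable_on_add) (auto simp: l2_def)
  moreover have "norm (f x * cnj (g x)) \<le> (cmod (f x))\<^sup>2 + (cmod (g x))\<^sup>2" for x
  proof -
    have "2 * (cmod (f x) * cmod (g x)) \<le> (cmod (f x))\<^sup>2 + (cmod (g x))\<^sup>2"
      using sum_squares_bound[of "cmod (f x)" "cmod (g x)"] by simp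
    moreover have "0 \<le> cmod (f x) * cmod (g x)" by simp
    ultimately show ?thesis by (simp only: norm_mult complex_mod_cnj)
  qed
  ultimately have "(\<lambda>x. norm (f x * cnj (g x))) summable_on V"
    by (rule summable_on_comparison_test) auto
  then show ?thesis
    by (rule abs_summable_summable)
qed

lemma l2_inner_self:
  assumes "f \<in> l2 V"
  shows "l2_inner V f f = complex_of_real (\<Sum>\<^sub>\<infinity>x\<in>V. (cmod (f x))\<^sup>2)"
proof -
  have "((\<lambda>x. complex_of_real ((cmod (f x))\<^sup>2)) has_sum
      complex_of_real (\<Sum>\<^sub>\<infinity>x\<in>V. (cmod (f x))\<^sup>2)) V"
    using assms by (intro has_sum_bounded_linear[OF bounded_linear_of_real] has_sum_infsum) (simp add: l2_def)
  then show ?thesis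
    unfolding l2_inner_def complex_norm_square by (rule infsumI)
qed

text \<open>Bessel's inequality for the point mass at \<open>x\<close>. Its projection \<open>g\<close> onto the span of the first
  \<open>n\<close> functions satisfies \<open>\<parallel>g\<parallel>\<^sup>2 = g(x)\<close>, and both equal the sum \<open>s\<close> in question; as
  \<open>|g(x)|\<^sup>2 \<le> \<parallel>g\<parallel>\<^sup>2\<close>, this gives \<open>s\<^sup>2 \<le> s\<close>.\<close>

lemma orthonormal_seq_bessel:
  assumes l2: "\<And>i. f i \<in> l2 V" and orth: "orthonormal_seq V f" and x: "x \<in> V"
  shows "(\<Sum>i<n. (cmod (f i x))\<^sup>2) \<le> 1"
proof -
  define g where "g = (\<lambda>y. \<Sum>i<n. cnj (f i x) * f i y)"
  define s where "s = (\<Sum>i<n. (cmod (f i x))\<^sup>2)"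
  have gx: "g x = complex_of_real s"
    unfolding g_def s_def of_real_sum
    by (intro sum.cong refl) (simp only: complex_norm_square mult.commute)
  have gl2: "g \<in> l2 V"
    unfolding g_def
  proof (induction n)
    case 0
    then show ?case by (simp add: l2_def)
  next
    case (Suc n)
    then show ?case using l2_add_bound(1)[OF Suc l2] by simp
  qed
  have ip: "(\<Sum>\<^sub>\<infinity>y\<in>V. f i y * cnj (f j y)) = (if i = j then 1 else 0)" for i j
    using orth by (simp add: orthonormal_seq_def l2_inner_def)
  have "complex_of_real (\<Sum>\<^sub>\<infinity>y\<in>V. (cmod (g y))\<^sup>2) = (\<Sum>\<^sub>\<infinity>y\<in>V. g y * cnj (g y))"
    using l2_inner_self[OF gl2] by (simp add: l2_inner_def)
  also have "\<dots> = (\<Sum>\<^sub>\<infinity>y\<in>V. \<Sum>i<n. \<Sum>j<n. (cnj (f i x) * f j x) * (f i y * cnj (f j y)))"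
    by (simp add: g_def sum_product cnj_sum mult_ac)
  also have "\<dots> = (\<Sum>i<n. \<Sum>j<n. (cnj (f i x) * f j x) * (\<Sum>\<^sub>\<infinity>y\<in>V. f i y * cnj (f j y)))"
    by (intro infsumI has_sum_finite_sum has_sum_cmult_right has_sum_infsum l2_inner_summable l2) auto
  also have "\<dots> = (\<Sum>i<n. cnj (f i x) * f i x)"
    by (simp add: ip if_distrib sum.delta cong: if_cong)
  also have "\<dots> = complex_of_real s"
    unfolding s_def of_real_sum
    by (intro sum.cong refl) (simp only: complex_norm_square mult.commute)
  finally have N: "(\<Sum>\<^sub>\<infinity>y\<in>V. (cmod (g y))\<^sup>2) = s"
    by (simp only: of_real_eq_iff)
  have "(\<Sum>y\<in>{x}. (cmod (g y))\<^sup>2) \<le> (\<Sum>\<^sub>\<infinity>y\<in>V. (cmod (g y))\<^sup>2)"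
    using gl2 x by (intro finite_sum_le_infsum) (auto simp: l2_def)
  then have "s * s \<le> s * 1"
    unfolding N by (simp add: gx power2_eq_square)
  moreover have "0 \<le> s"
    by (auto simp: s_def intro: sum_nonneg)
  ultimately show ?thesis
    by (cases "s = 0") (auto simp: s_def[symmetric])
qed

lemma orthonormal_seq_pointwise_tendsto_0:
  assumes "\<And>i. f i \<in> l2 V" "orthonormal_seq V f" "x \<in> V"
  shows "(\<lambda>i. (cmod (f i x))\<^sup>2) \<longlonglongrightarrow> 0"
proof -
  have "summable (\<lambda>i. (cmod (f i x))\<^sup>2)"
    by (rule summableI_nonneg_bounded[where x = 1]) (use orthonormal_seq_bessel[OF assms] in auto)
  then show ?thesis
    by (rule summable_LIMSEQ_zero)
qed


section \<open>Positive supersolutions and the maximal domain\<close>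

lemma neighbours_sym: "y \<in> neighbours E x \<longleftrightarrow> x \<in> neighbours E y"
  by (simp add: neighbours_def insert_commute)

lemma neighbours_subset:
  assumes "simple_graph V E"
  shows "neighbours E x \<subseteq> V"
  using assms by (auto simp: neighbours_def simple_graph_def)

text \<open>Barta's argument. On each edge inside \<open>S\<close>, the contributions of its two orientations to the
  difference of the two sides add up to
  \<open>(\<psi> x * u y - \<psi> y * u x)\<^sup>2 / (u x * u y) \<ge> 0\<close>. An edge that leaves \<open>S\<close> occurs in only one
  orientation, but there \<open>\<psi> y = 0\<close> and what remains is \<open>(\<psi> x)\<^sup>2 * u y / u x \<ge> 0\<close>.\<close>

lemma ground_state_inequality:
  fixes \<psi> u :: "'a \<Rightarrow> real"
  assumes S: "finite S" and fin: "\<And>x. x \<in> S \<Longrightarrow> finite (neighbours E x)"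
    and u: "\<And>x. u x > 0"
    and supp: "\<And>x y. x \<in> S \<Longrightarrow> y \<in> neighbours E x \<Longrightarrow> y \<notin> S \<Longrightarrow> \<psi> y = 0"
  shows "(\<Sum>x\<in>S. (\<psi> x)\<^sup>2 / u x * (\<Sum>y\<in>neighbours E x. u x - u y))
       \<le> (\<Sum>x\<in>S. \<psi> x * (\<Sum>y\<in>neighbours E x. \<psi> x - \<psi> y))"
proof -
  define D where "D x y = (\<psi> x)\<^sup>2 * u y / u x - \<psi> x * \<psi> y" for x y
  let ?A = "\<Sum>x\<in>S. \<Sum>y\<in>S. if y \<in> neighbours E x then D x y else 0"
  have D: "0 \<le> D x y + D y x" for x y
  proof -
    have "D x y + D y x = (\<psi> x * u y - \<psi> y * u x)\<^sup>2 / (u x * u y)"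
      using u[of x] u[of y] by (simp add: D_def field_simps power2_eq_square)
    then show ?thesis
      using u[of x] u[of y] by simp
  qed
  \<comment> \<open>Adjacency is symmetric, so \<open>D x y\<close> may be replaced by its transpose and the two averaged.\<close>
  have "?A = (\<Sum>x\<in>S. \<Sum>y\<in>S. if y \<in> neighbours E x then D y x else 0)" (is "_ = ?A'")
    by (subst sum.swap) (simp add: neighbours_sym)
  then have "2 * ?A = ?A + ?A'" by linarith
  also have "\<dots> = (\<Sum>x\<in>S. \<Sum>y\<in>S. if y \<in> neighbours E x then D x y + D y x else 0)"
    unfolding sum.distrib[symmetric] by (intro sum.cong refl) simp
  also have "\<dots> \<ge> 0"
    using D by (intro sum_nonneg) auto
  finally have "0 \<le> ?A" by simp
  also have "?A \<le> (\<Sum>x\<in>S. \<Sum>y\<in>neighbours E x. D x y)"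
  proof (rule sum_mono)
    fix x assume x: "x \<in> S"
    have "(\<Sum>y\<in>S. if y \<in> neighbours E x then D x y else 0) = (\<Sum>y\<in>S \<inter> neighbours E x. D x y)"
      using S by (simp add: sum.inter_restrict)
    also have "\<dots> \<le> (\<Sum>y\<in>neighbours E x. D x y)"
    proof (rule sum_mono2)
      fix y assume "y \<in> neighbours E x - S \<inter> neighbours E x"
      then show "0 \<le> D x y"
        using supp[OF x, of y] u[of x] u[of y] by (auto simp: D_def)
    qed (use fin x in auto)
    finally show "(\<Sum>y\<in>S. if y \<in> neighbours E x then D x y else 0) \<le> (\<Sum>y\<in>neighbours E x. D x y)" .
  qed
  also have "\<dots> = (\<Sum>x\<in>S. \<psi> x * (\<Sum>y\<in>neighbours E x. \<psi> x - \<psi> y))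
      - (\<Sum>x\<in>S. (\<psi> x)\<^sup>2 / u x * (\<Sum>y\<in>neighbours E x. u x - u y))"
    unfolding sum_distrib_left sum_subtractf[symmetric]
  proof (intro sum.cong refl)
    fix x y
    show "D x y = \<psi> x * (\<psi> x - \<psi> y) - (\<psi> x)\<^sup>2 / u x * (u x - u y)"
      using u[of x] by (simp add: D_def field_simps power2_eq_square)
  qed
  finally show ?thesis by simp
qed

text \<open>Multiplying \<open>\<Delta> f(x)\<close> by the unimodular \<open>a\<close> that makes \<open>a * f x\<close> equal to \<open>|f x|\<close> and taking
  real parts shows \<open>\<Delta> |f| \<le> |\<Delta> f|\<close> at \<open>x\<close>. Truncation at level \<open>\<epsilon>\<close> only lowers the left side where
  \<open>|f x| > \<epsilon>\<close>: it subtracts all of \<open>\<epsilon>\<close> at \<open>x\<close> and at most \<open>\<epsilon>\<close> at each neighbour.\<close>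

lemma truncation_kato_inequality:
  assumes "\<epsilon> \<ge> 0" "\<epsilon> < cmod (f x)"
  shows "(\<Sum>y\<in>neighbours E x. max 0 (cmod (f x) - \<epsilon>) - max 0 (cmod (f y) - \<epsilon>))
       \<le> cmod (laplacian E f x)"
proof -
  define a where "a = cnj (f x) / cmod (f x)"
  have fx: "cmod (f x) \<noteq> 0"
    using assms by linarith
  then have a1: "cmod a = 1"
    by (simp add: a_def norm_divide)
  have "a * f x = complex_of_real ((cmod (f x))\<^sup>2) / cmod (f x)"
    unfolding a_def complex_norm_square by (simp add: mult.commute)
  also have "\<dots> = cmod (f x)"
    using fx by (simp add: power2_eq_square)
  finally have afx: "a * f x = cmod (f x)" .
  have "(\<Sum>y\<in>neighbours E x. max 0 (cmod (f x) - \<epsilon>) - max 0 (cmod (f y) - \<epsilon>))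
      \<le> (\<Sum>y\<in>neighbours E x. Re (a * (f x - f y)))"
  proof (rule sum_mono)
    fix y
    have "Re (a * f y) \<le> cmod (f y)"
      using complex_Re_le_cmod[of "a * f y"] a1 by (simp add: norm_mult)
    then have "cmod (f x) - cmod (f y) \<le> Re (a * (f x - f y))"
      by (simp only: right_diff_distrib afx minus_complex.sel Re_complex_of_real)
    moreover have "max 0 (cmod (f x) - \<epsilon>) - max 0 (cmod (f y) - \<epsilon>) \<le> cmod (f x) - cmod (f y)"
      using assms by linarith
    ultimately show "max 0 (cmod (f x) - \<epsilon>) - max 0 (cmod (f y) - \<epsilon>) \<le> Re (a * (f x - f y))"
      by linarith
  qed
  also have "\<dots> = Re (a * laplacian E f x)"
    by (simp only: laplacian_def sum_distrib_left Re_sum)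
  also have "\<dots> \<le> cmod (laplacian E f x)"
    using complex_Re_le_cmod[of "a * laplacian E f x"] a1 by (simp add: norm_mult)
  finally show ?thesis .
qed

text \<open>The energy estimate for the weight \<open>q\<close>, valid on the whole maximal domain because the
  truncations of \<open>|f|\<close> at positive levels have finite support. Finite partial sums on the left
  avoid asking whether the full weighted sum converges.\<close>

lemma laplacian_domain_weighted_bound:
  fixes u q :: "'a \<Rightarrow> real"
  assumes G: "simple_graph V E" "locally_finite V E"
    and u: "\<And>x. u x > 0"
    and super: "\<And>x. x \<in> V \<Longrightarrow> q x * u x \<le> (\<Sum>y\<in>neighbours E x. u x - u y)"
    and q: "\<And>x. x \<in> V \<Longrightarrow> q x \<ge> 0"
    and f: "f \<in> laplacian_domain V E"
    and F: "finite F" "F \<subseteq> V"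
  shows "(\<Sum>x\<in>F. q x * (cmod (f x))\<^sup>2)
       \<le> ((\<Sum>\<^sub>\<infinity>x\<in>V. (cmod (f x))\<^sup>2) + (\<Sum>\<^sub>\<infinity>x\<in>V. (cmod (laplacian E f x))\<^sup>2)) / 2"
    (is "_ \<le> ?R")
proof -
  have fl: "f \<in> l2 V" and Lf: "laplacian E f \<in> l2 V"
    using f by (auto simp: laplacian_domain_def)
  have bound: "(\<Sum>x\<in>F. q x * (max 0 (cmod (f x) - \<epsilon>))\<^sup>2) \<le> ?R" if \<epsilon>: "\<epsilon> > 0" for \<epsilon>
  proof -
    define \<psi> where "\<psi> x = max 0 (cmod (f x) - \<epsilon>)" for x
    define S where "S = {x \<in> V. \<epsilon> < cmod (f x)}"
    have S: "finite S" "S \<subseteq> V"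
      using l2_finite_superlevel[OF fl \<epsilon>] by (auto simp: S_def)
    have out: "\<psi> x = 0" if "x \<in> V" "x \<notin> S" for x
      using that by (auto simp: S_def \<psi>_def)
    have "(\<Sum>x\<in>F. q x * (\<psi> x)\<^sup>2) \<le> (\<Sum>x\<in>F \<union> S. q x * (\<psi> x)\<^sup>2)"
      using F S q by (intro sum_mono2) auto
    also have "\<dots> = (\<Sum>x\<in>S. q x * (\<psi> x)\<^sup>2)"
      using F S out by (intro sum.mono_neutral_right) auto
    also have "\<dots> \<le> (\<Sum>x\<in>S. (\<psi> x)\<^sup>2 / u x * (\<Sum>y\<in>neighbours E x. u x - u y))"
    proof (rule sum_mono)
      fix x assume "x \<in> S"
      then have "(\<psi> x)\<^sup>2 / u x * (q x * u x) \<le> (\<psi> x)\<^sup>2 / u x * (\<Sum>y\<in>neighbours E x. u x - u y)"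
        using S super[of x] u[of x] by (intro mult_left_mono) auto
      then show "q x * (\<psi> x)\<^sup>2 \<le> (\<psi> x)\<^sup>2 / u x * (\<Sum>y\<in>neighbours E x. u x - u y)"
        using u[of x] by (simp add: mult.commute)
    qed
    also have "\<dots> \<le> (\<Sum>x\<in>S. \<psi> x * (\<Sum>y\<in>neighbours E x. \<psi> x - \<psi> y))"
      using S G neighbours_subset[OF G(1)] out
      by (intro ground_state_inequality u) (auto simp: locally_finite_def, blast)
    also have "\<dots> \<le> (\<Sum>x\<in>S. ((cmod (f x))\<^sup>2 + (cmod (laplacian E f x))\<^sup>2) / 2)"
    proof (rule sum_mono)
      fix x assume "x \<in> S"
      then have x: "\<epsilon> < cmod (f x)" by (simp add: S_def)
      have "\<psi> x * (\<Sum>y\<in>neighbours E x. \<psi> x - \<psi> y) \<le> cmod (f x) * cmod (laplacian E f x)"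
        using truncation_kato_inequality[of \<epsilon> f x E] x \<epsilon>
        unfolding \<psi>_def by (intro order_trans[OF mult_left_mono mult_right_mono]) auto
      also have "\<dots> \<le> ((cmod (f x))\<^sup>2 + (cmod (laplacian E f x))\<^sup>2) / 2"
        using sum_squares_bound[of "cmod (f x)" "cmod (laplacian E f x)"] by simp
      finally show "\<psi> x * (\<Sum>y\<in>neighbours E x. \<psi> x - \<psi> y)
          \<le> ((cmod (f x))\<^sup>2 + (cmod (laplacian E f x))\<^sup>2) / 2" .
    qed
    also have "\<dots> = ((\<Sum>x\<in>S. (cmod (f x))\<^sup>2) + (\<Sum>x\<in>S. (cmod (laplacian E f x))\<^sup>2)) / 2"
      by (simp add: sum.distrib flip: sum_divide_distrib)
    also have "\<dots> \<le> ?R"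
      using S fl Lf by (intro divide_right_mono add_mono finite_sum_le_infsum) (auto simp: l2_def)
    finally show ?thesis by (simp add: \<psi>_def)
  qed
  have "((\<lambda>\<epsilon>. \<Sum>x\<in>F. q x * (max 0 (cmod (f x) - \<epsilon>))\<^sup>2) \<longlongrightarrow>
      (\<Sum>x\<in>F. q x * (max 0 (cmod (f x) - 0))\<^sup>2)) (at_right 0)"
    by (intro tendsto_intros)
  moreover have "eventually (\<lambda>\<epsilon>. (\<Sum>x\<in>F. q x * (max 0 (cmod (f x) - \<epsilon>))\<^sup>2) \<le> ?R) (at_right 0)"
    using bound by (auto simp: eventually_at_filter)
  ultimately have "(\<Sum>x\<in>F. q x * (max 0 (cmod (f x) - 0))\<^sup>2) \<le> ?R"
    by (rule tendsto_upperbound) simp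
  then show ?thesis by simp
qed


section \<open>The distance to the base vertex\<close>

lemma graph_dist_walk:
  assumes "graph_connected V E" "x \<in> V" "y \<in> V"
  shows "(x, y) \<in> adj_rel E ^^ graph_dist E x y"
proof -
  have "\<exists>n. (x, y) \<in> adj_rel E ^^ n"
    using assms by (auto simp: graph_connected_def dest: rtrancl_imp_relpow)
  then show ?thesis
    unfolding graph_dist_def by (rule LeastI_ex)
qed

lemma graph_dist_neighbour_le:
  assumes "graph_connected V E" "y \<in> V" "z \<in> V" "y \<in> neighbours E x"
  shows "graph_dist E x z \<le> Suc (graph_dist E y z)"
proof -
  have "(x, z) \<in> adj_rel E ^^ Suc (graph_dist E y z)"
    by (rule relpow_Suc_I2[OF _ graph_dist_walk[OF assms(1-3)]])
      (use assms in \<open>auto simp: adj_rel_def neighbours_def\<close>)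
  then show ?thesis
    unfolding graph_dist_def[of E x] by (rule Least_le)
qed

text \<open>Prepending an edge to a walk of length \<open>n\<close> ending at \<open>x0\<close> leaves finitely many choices of the new
  starting point, so induction on \<open>n\<close> shows that finitely many vertices have such a walk.\<close>

lemma finite_graph_ball:
  assumes "simple_graph V E" "locally_finite V E" "graph_connected V E" "x0 \<in> V"
  shows "finite (graph_ball V E x0 r)"
proof -
  have W: "finite {x. (x, x0) \<in> adj_rel E ^^ n} \<and> {x. (x, x0) \<in> adj_rel E ^^ n} \<subseteq> V" for n
  proof (induction n)
    case 0
    then show ?case using assms by auto
  next
    case (Suc n)
    have "{x. (x, x0) \<in> adj_rel E ^^ Suc n}
        = (\<Union>y\<in>{x. (x, x0) \<in> adj_rel E ^^ n}. neighbours E y)"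
      unfolding relpow.simps(2) relpow_commute[symmetric]
      by (auto simp: adj_rel_def neighbours_def insert_commute)
    then show ?case
      using Suc assms neighbours_subset[OF assms(1)] by (auto simp: locally_finite_def)
  qed
  have "graph_ball V E x0 r \<subseteq> (\<Union>n\<le>r. {x. (x, x0) \<in> adj_rel E ^^ n})"
    using graph_dist_walk[OF assms(3) _ assms(4)] by (auto simp: graph_ball_def)
  then show ?thesis
    using W by (rule_tac finite_subset) auto
qed

text \<open>For \<open>u = s ^ r\<close> one computes \<open>\<Delta> u(x) = (1 - s) * u(x) * (m\<^sub>+\<^sub>1(x) - m\<^sub>-\<^sub>1(x) / s)\<close>, since
  distances of neighbours differ by at most one and neighbours on the same sphere contribute
  nothing. The choice of \<open>s\<close> makes \<open>1 / s - 1 = c / 2\<close>; hence replacing \<open>m\<^sub>-\<^sub>1\<close> by \<open>m\<^sub>-\<^sub>1 / s\<close> costs at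
  most \<open>c / 2 * m(x)\<close>, half of the available \<open>c * m(x)\<close>.\<close>

lemma radial_power_supersolution:
  fixes c s :: real
  assumes G: "simple_graph V E" "locally_finite V E" "graph_connected V E" "x0 \<in> V" and x: "x \<in> V"
    and c: "c > 0" and s: "s = 1 / (1 + c / 2)"
    and curv: "(real (m_plus E x0 x) - real (m_minus E x0 x)) / real (valence E x) \<ge> c"
  shows "(1 - s) * (c / 2) * real (valence E x) * s ^ graph_dist E x x0
    \<le> (\<Sum>y\<in>neighbours E x. s ^ graph_dist E x x0 - s ^ graph_dist E y x0)"
proof -
  define r where "r y = graph_dist E y x0" for y
  define P where "P = {y \<in> neighbours E x. r y = r x + 1}"
  define M where "M = {y \<in> neighbours E x. r y + 1 = r x}"
  have fin: "finite (neighbours E x)" using G x by (simp add: locally_finite_def)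
  have s01: "0 < s" "s < 1" and inv: "1 / s = 1 + c / 2" using c by (auto simp: s)
  \<comment> \<open>A quotient with denominator \<open>0\<close> is \<open>0\<close>, so the lower bound on it excludes valence \<open>0\<close>.\<close>
  have m0: "real (valence E x) > 0"
    using curv c by (cases "valence E x = 0") auto
  have tri: "r y = r x + 1 \<or> r y + 1 = r x \<or> r y = r x" if "y \<in> neighbours E x" for y
  proof -
    have "y \<in> V" using that neighbours_subset[OF G(1)] by auto
    then have "r x \<le> Suc (r y)" "r y \<le> Suc (r x)"
      using that x G by (auto simp: r_def neighbours_sym[of x] intro!: graph_dist_neighbour_le)
    then show ?thesis by linarith
  qed
  have Mle: "card M \<le> valence E x"
    unfolding valence_def M_def by (intro card_mono fin) auto
  have curv': "real (card P) - real (card M) \<ge> c * real (valence E x)"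
    using curv m0 by (simp add: P_def M_def r_def m_plus_def m_minus_def field_simps)
  have "(\<Sum>y\<in>neighbours E x. s ^ r x - s ^ r y) = (\<Sum>y\<in>P \<union> M. s ^ r x - s ^ r y)"
  proof (rule sum.mono_neutral_right[OF fin])
    show "P \<union> M \<subseteq> neighbours E x"
      by (auto simp: P_def M_def)
    show "\<forall>y\<in>neighbours E x - (P \<union> M). s ^ r x - s ^ r y = 0"
      using tri by (force simp: P_def M_def)
  qed
  also have "\<dots> = (\<Sum>y\<in>P. s ^ r x - s ^ r y) + (\<Sum>y\<in>M. s ^ r x - s ^ r y)"
    using fin by (intro sum.union_disjoint) (auto simp: P_def M_def)
  also have "(\<Sum>y\<in>P. s ^ r x - s ^ r y) = (\<Sum>y\<in>P. s ^ r x * (1 - s))"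
    by (intro sum.cong) (auto simp: P_def algebra_simps)
  also have "(\<Sum>y\<in>M. s ^ r x - s ^ r y) = (\<Sum>y\<in>M. s ^ r x * (1 - 1 / s))"
  proof (intro sum.cong refl)
    fix y assume "y \<in> M"
    then have "r x = Suc (r y)" by (simp add: M_def)
    then show "s ^ r x - s ^ r y = s ^ r x * (1 - 1 / s)"
      using s01 by (simp add: field_simps)
  qed
  also have "(\<Sum>y\<in>P. s ^ r x * (1 - s)) + (\<Sum>y\<in>M. s ^ r x * (1 - 1 / s))
      = (1 - s) * s ^ r x * (real (card P) - (1 / s) * real (card M))"
    using s01 by (simp add: field_simps)
  finally have eq: "(\<Sum>y\<in>neighbours E x. s ^ r x - s ^ r y)
      = (1 - s) * s ^ r x * (real (card P) - (1 / s) * real (card M))" .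
  have "c / 2 * real (card M) \<le> c / 2 * real (valence E x)"
    using Mle c by (intro mult_left_mono) auto
  then have "c / 2 * real (valence E x) \<le> real (card P) - (1 / s) * real (card M)"
    using curv' by (simp add: inv algebra_simps)
  then have "(1 - s) * s ^ r x * (c / 2 * real (valence E x))
      \<le> (1 - s) * s ^ r x * (real (card P) - (1 / s) * real (card M))"
    using s01 by (intro mult_left_mono) auto
  then show ?thesis
    by (simp add: eq[unfolded r_def] r_def mult_ac)
qed

lemma min_valence_outside_le:
  assumes "x \<in> V" "x \<notin> graph_ball V E x0 r"
  shows "min_valence_outside V E x0 r \<le> valence E x"
  unfolding min_valence_outside_def using assms by (intro cINF_lower) auto


section \<open>Absence of essential spectrum\<close>

theorem theorem4p5:
  fixes V :: "'a set" and E :: "'a set set" and x0 :: 'a and c :: real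
  assumes "simple_graph V E"
    and "infinite V"
    and "locally_finite V E"
    and "graph_connected V E"
    and "x0 \<in> V"
    and "c > 0"
    and "\<And>x. x \<in> V \<Longrightarrow> (real (m_plus E x0 x) - real (m_minus E x0 x)) / real (valence E x) \<ge> c"
    and "filterlim (\<lambda>r. min_valence_outside V E x0 r) at_top at_top"
  shows "essential_spectrum V E = {}"
proof (rule ccontr)
  assume "essential_spectrum V E \<noteq> {}"
  then obtain z f where dom: "\<And>i. f i \<in> laplacian_domain V E" and orth: "orthonormal_seq V f"
    and lim: "(\<lambda>i. l2_norm V (\<lambda>x. laplacian E (f i) x - z * f i x)) \<longlonglongrightarrow> 0"
    unfolding essential_spectrum_def by blast
  have fl: "f i \<in> l2 V" and Lf: "laplacian E (f i) \<in> l2 V" for i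
    using dom[of i] by (auto simp: laplacian_domain_def)
  define s where "s = 1 / (1 + c / 2)"
  define k where "k = (1 - s) * (c / 2)"
  have s: "0 < s" "s < 1" and k: "k > 0"
    using \<open>c > 0\<close> by (auto simp: s_def k_def)
  have norm1: "(\<Sum>\<^sub>\<infinity>x\<in>V. (cmod (f i x))\<^sup>2) = 1" for i
    using l2_inner_self[OF fl[of i]] orth by (simp add: orthonormal_seq_def)
  \<comment> \<open>Half the sum of \<open>\<parallel>f\<^sub>i\<parallel>\<^sup>2 = 1\<close> and the bound \<open>2 + 2 * |z|\<^sup>2\<close> on \<open>\<parallel>\<Delta> f\<^sub>i\<parallel>\<^sup>2\<close> once \<open>\<parallel>\<Delta> f\<^sub>i - z f\<^sub>i\<parallel> < 1\<close>.\<close>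
  define C where "C = (1 + (2 + 2 * (cmod z)\<^sup>2)) / 2"
  have energy: "k * (\<Sum>x\<in>F. real (valence E x) * (cmod (f i x))\<^sup>2) \<le> C"
    if i: "l2_norm V (\<lambda>x. laplacian E (f i) x - z * f i x) < 1" and F: "finite F" "F \<subseteq> V" for i F
  proof -
    let ?g = "\<lambda>x. laplacian E (f i) x + (- z) * f i x"
    have g: "?g \<in> l2 V" by (rule l2_add_bound(1)[OF Lf fl])
    have "(\<Sum>\<^sub>\<infinity>x\<in>V. (cmod (?g x))\<^sup>2) \<le> 1"
      using i by (simp add: l2_norm_def)
    then have "(\<Sum>\<^sub>\<infinity>x\<in>V. (cmod (laplacian E (f i) x))\<^sup>2) \<le> 2 + 2 * (cmod z)\<^sup>2"
      using l2_add_bound(2)[OF g fl, of z i] by (simp add: norm1)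
    moreover have "(\<Sum>x\<in>F. (k * real (valence E x)) * (cmod (f i x))\<^sup>2)
       \<le> ((\<Sum>\<^sub>\<infinity>x\<in>V. (cmod (f i x))\<^sup>2) + (\<Sum>\<^sub>\<infinity>x\<in>V. (cmod (laplacian E (f i) x))\<^sup>2)) / 2"
    proof (rule laplacian_domain_weighted_bound[where u = "\<lambda>x. s ^ graph_dist E x x0"])
      fix x assume "x \<in> V"
      then show "k * real (valence E x) * s ^ graph_dist E x x0
          \<le> (\<Sum>y\<in>neighbours E x. s ^ graph_dist E x x0 - s ^ graph_dist E y x0)"
        unfolding k_def using assms by (intro radial_power_supersolution s_def) auto
    qed (use assms dom s k F in auto)
    ultimately show ?thesis
      by (simp add: C_def norm1 sum_distrib_left mult.assoc)
  qed
  \<comment> \<open>Beyond this radius the weight \<open>k * m\<close> is at least \<open>2 * C\<close>, so at most mass \<open>1/2\<close> fits there.\<close>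
  have "eventually (\<lambda>r. nat \<lceil>2 * C / k\<rceil> + 1 \<le> min_valence_outside V E x0 r) at_top"
    using assms(8) by (simp add: filterlim_at_top)
  then obtain r where r: "nat \<lceil>2 * C / k\<rceil> + 1 \<le> min_valence_outside V E x0 r"
    using eventually_happens'[OF sequentially_bot] by blast
  define B where "B = graph_ball V E x0 r"
  have B: "finite B" "B \<subseteq> V"
    using finite_graph_ball[OF assms(1,3,4,5)] by (auto simp: B_def graph_ball_def)
  have val: "2 * C / k \<le> real (valence E x)" if "x \<in> V - B" for x
    using r min_valence_outside_le[of x V E x0 r] that unfolding B_def by simp linarith
  have tail: "(\<Sum>\<^sub>\<infinity>x\<in>V - B. (cmod (f i x))\<^sup>2) \<le> 1 / 2"
    if i: "l2_norm V (\<lambda>x. laplacian E (f i) x - z * f i x) < 1" for i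
  proof (rule infsum_le_finite_sums)
    show "(\<lambda>x. (cmod (f i x))\<^sup>2) summable_on (V - B)"
      using fl[of i] by (auto simp: l2_def intro: summable_on_subset_banach)
    fix F assume F: "finite F" "F \<subseteq> V - B"
    have "2 * C * (\<Sum>x\<in>F. (cmod (f i x))\<^sup>2) = k * (\<Sum>x\<in>F. 2 * C / k * (cmod (f i x))\<^sup>2)"
      using k by (simp add: sum_distrib_left)
    also have "\<dots> \<le> k * (\<Sum>x\<in>F. real (valence E x) * (cmod (f i x))\<^sup>2)"
      using k val F by (intro mult_left_mono sum_mono mult_right_mono) auto
    also have "\<dots> \<le> C"
      using F by (intro energy i) auto
    finally have "C * (\<Sum>x\<in>F. (cmod (f i x))\<^sup>2) \<le> C * (1 / 2)" by simp
    moreover have "C > 0" by (auto simp: C_def intro!: divide_pos_pos add_pos_nonneg)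
    ultimately show "(\<Sum>x\<in>F. (cmod (f i x))\<^sup>2) \<le> 1 / 2"
      by (simp only: mult_le_cancel_left_pos)
  qed
  have "(\<lambda>i. \<Sum>x\<in>B. (cmod (f i x))\<^sup>2) \<longlonglongrightarrow> (\<Sum>x\<in>B. 0)"
    using B by (intro tendsto_sum orthonormal_seq_pointwise_tendsto_0[OF fl orth]) auto
  then have "eventually (\<lambda>i. (\<Sum>x\<in>B. (cmod (f i x))\<^sup>2) < 1 / 2) sequentially"
    by (intro order_tendstoD) auto
  moreover have "eventually (\<lambda>i. l2_norm V (\<lambda>x. laplacian E (f i) x - z * f i x) < 1) sequentially"
    using lim by (intro order_tendstoD) auto
  ultimately have "eventually (\<lambda>i. (\<Sum>x\<in>B. (cmod (f i x))\<^sup>2) < 1 / 2 \<and>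
      l2_norm V (\<lambda>x. laplacian E (f i) x - z * f i x) < 1) sequentially"
    by (rule eventually_conj)
  then obtain i where i: "(\<Sum>x\<in>B. (cmod (f i x))\<^sup>2) < 1 / 2"
      "l2_norm V (\<lambda>x. laplacian E (f i) x - z * f i x) < 1"
    using eventually_happens'[OF sequentially_bot] by blast
  have "1 = (\<Sum>\<^sub>\<infinity>x\<in>B \<union> (V - B). (cmod (f i x))\<^sup>2)"
    using norm1[of i] B by (simp add: Un_absorb1)
  also have "\<dots> = (\<Sum>\<^sub>\<infinity>x\<in>B. (cmod (f i x))\<^sup>2) + (\<Sum>\<^sub>\<infinity>x\<in>V - B. (cmod (f i x))\<^sup>2)"
    using fl[of i] B by (intro infsum_Un_disjoint) (auto simp: l2_def intro: summable_on_subset_banach)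
  finally show False
    using i(1) tail[OF i(2)] B by simp
qed

end
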